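(* Let $\mathcal L$ be a finite modular lattice equipped with a cover-weighting $w$. Suppose (CW1) and (CW2) hold for every interval of length $2$ in $\mathcal L$. Then $(\mathcal L,w)$ satisfies the interval-weight axioms (IW1) and (IW2). In particular, $(\mathcal L,r_w)$ is an $\mathcal L$-polymatroid, where $r_w(A)=\sum_{i=1}^m w([X_{i-1},X_i])$ for any maximal chain $\mathbf 0=X_0\lessdot\cdots\lessdot X_m=A$.
   Context: A cover-weighting assigns to each cover $A\lessdot B$ of $\mathcal L$ a value $w([A,B])\ge0$. Cover-weight axioms, for an interval $[A,B]$ of length two and $X,Y$ with $A<X<B$, $A<Y<B$: - (CW1) $w([A,X])+w([X,B])=w([A,Y])+w([Y,B])$; - (CW2) $w([A,X])\ge w([Y,B])$ whenever $X\ne Y$. Interval-weight axioms: - (IW1) For every interval $[A,B]$, the sum of $w$ over the covers of a maximal chain from $A$ to $B$ does not depend on the chain; this value is denoted $w([A,B])$. - (IW2) (IW1) holds, and $w([A,X\vee A])\le w([A\wedge X,X])$ for all $A,X$. An $\mathcal L$-polymatroid is a pair $(\mathcal L,r)$ with $r:\mathcal L\to\mathbb R$ such that, for some $t\ge0$, $0\le r(A)\le t\,\mathrm h(A)$ (with $\mathrm h$ the height), $r$ is increasing, and $r(A)-r(A\wedge B)\ge r(A\vee B)-r(B)$ for all $A,B$. *)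

theory Defs
  imports Complex_Main
begin

class modular_lattice = lattice +
  assumes modular: "x \<le> z \<Longrightarrow> sup x (inf y z) = inf (sup x y) z"

definition covered_by :: "'a::order \<Rightarrow> 'a \<Rightarrow> bool" where
  "covered_by A B \<longleftrightarrow> A < B \<and> (\<nexists>X. A < X \<and> X < B)"

text \<open>The length of a chain is its cardinality minus one; the length of an interval is the
  largest length of a chain contained in it.\<close>

definition interval_length :: "'a::{finite,order} \<Rightarrow> 'a \<Rightarrow> nat" where
  "interval_length A B = Max {card C - 1 | C. C \<subseteq> {A..B} \<and> Complete_Partial_Order.chain (\<le>) C}"

definition height :: "'a::{finite,order_bot} \<Rightarrow> nat" where
  "height A = interval_length bot A"

text \<open>A maximal chain from \<open>A\<close> to \<open>B\<close> is listed in increasing order, end points included.\<close>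

definition maximal_chain :: "'a::order \<Rightarrow> 'a \<Rightarrow> 'a list \<Rightarrow> bool" where
  "maximal_chain A B Xs \<longleftrightarrow> Xs \<noteq> [] \<and> hd Xs = A \<and> last Xs = B \<and> successively covered_by Xs"

text \<open>A weighting is a total function of two arguments, but only its values \<open>w A B\<close> at covers
  are constrained or used.\<close>

definition cover_weighting :: "('a::order \<Rightarrow> 'a \<Rightarrow> real) \<Rightarrow> bool" where
  "cover_weighting w \<longleftrightarrow> (\<forall>A B. covered_by A B \<longrightarrow> 0 \<le> w A B)"

definition CW1 :: "('a::order \<Rightarrow> 'a \<Rightarrow> real) \<Rightarrow> 'a \<Rightarrow> 'a \<Rightarrow> bool" where
  "CW1 w A B \<longleftrightarrow>
    (\<forall>X Y. A < X \<and> X < B \<and> A < Y \<and> Y < B \<longrightarrow> w A X + w X B = w A Y + w Y B)"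

definition CW2 :: "('a::order \<Rightarrow> 'a \<Rightarrow> real) \<Rightarrow> 'a \<Rightarrow> 'a \<Rightarrow> bool" where
  "CW2 w A B \<longleftrightarrow>
    (\<forall>X Y. A < X \<and> X < B \<and> A < Y \<and> Y < B \<and> X \<noteq> Y \<longrightarrow> w A X \<ge> w Y B)"

definition chain_weight :: "('a \<Rightarrow> 'a \<Rightarrow> real) \<Rightarrow> 'a list \<Rightarrow> real" where
  "chain_weight w Xs = (\<Sum>i = 1..<length Xs. w (Xs ! (i - 1)) (Xs ! i))"

definition IW1 :: "('a::order \<Rightarrow> 'a \<Rightarrow> real) \<Rightarrow> bool" where
  "IW1 w \<longleftrightarrow>
    (\<forall>A B. A \<le> B \<longrightarrow>
      (\<forall>Xs Ys. maximal_chain A B Xs \<and> maximal_chain A B Ys \<longrightarrow>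
        chain_weight w Xs = chain_weight w Ys))"

text \<open>The common weight of all maximal chains from \<open>A\<close> to \<open>B\<close>; meaningful only under \<^const>\<open>IW1\<close>.\<close>

definition interval_weight :: "('a::order \<Rightarrow> 'a \<Rightarrow> real) \<Rightarrow> 'a \<Rightarrow> 'a \<Rightarrow> real" where
  "interval_weight w A B = (THE s. \<exists>Xs. maximal_chain A B Xs \<and> s = chain_weight w Xs)"

definition IW2 :: "('a::lattice \<Rightarrow> 'a \<Rightarrow> real) \<Rightarrow> bool" where
  "IW2 w \<longleftrightarrow> IW1 w \<and>
    (\<forall>A X. interval_weight w A (sup X A) \<le> interval_weight w (inf A X) X)"

definition polymatroid :: "('a::{finite,bounded_lattice} \<Rightarrow> real) \<Rightarrow> bool" where
  "polymatroid r \<longleftrightarrow>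
    (\<exists>t\<ge>0. \<forall>A. 0 \<le> r A \<and> r A \<le> t * real (height A)) \<and>
    mono r \<and>
    (\<forall>A B. r A - r (inf A B) \<ge> r (sup A B) - r B)"

definition weight_rank :: "('a::order_bot \<Rightarrow> 'a \<Rightarrow> real) \<Rightarrow> 'a \<Rightarrow> real" where
  "weight_rank w A = interval_weight w bot A"

end

theory Submission imports Defs begin

text \<open>In a modular lattice two distinct covers of \<open>A\<close> span an interval of length two, so (CW1)
  allows the first steps of two maximal chains from \<open>A\<close> to \<open>B\<close> to be exchanged; induction along
  the lattice (as in the Jordan-Hoelder theorem) gives (IW1).
  Likewise (CW2) says that the weight of a cover does not grow when it is translated along a
  cover. Translating \<open>P \<lessdot> X\<close> step by step along a chain from \<open>P\<close> to \<open>A\<close> bounds the weight of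
  \<open>A \<lessdot> X \<squnion> A\<close>, and summing such bounds over a maximal chain of \<open>[A \<sqinter> X, X]\<close> gives (IW2).
  Additivity of the interval weight turns (IW2) into submodularity of the rank.\<close>

section \<open>Covers in finite orders\<close>

lemma upward_induct:
  fixes A :: "'a::{finite,order}"
  assumes "\<And>A. (\<And>X. A < X \<Longrightarrow> P X) \<Longrightarrow> P A"
  shows "P A"
proof (induction A rule: measure_induct_rule[where f = "\<lambda>A. card {A<..}"])
  case (less A)
  show ?case
  proof (rule assms)
    fix X assume "A < X"
    then have "{X<..} \<subset> {A<..}" by auto
    then have "card {X<..} < card {A<..}" by (intro psubset_card_mono) auto
    then show "P X" by (rule less)
  qed
qed

lemma ex_cover_below:
  fixes A B :: "'a::{finite,order}"
  assumes "A < B"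
  obtains X where "covered_by A X" "X \<le> B"
proof -
  obtain X where X: "X \<in> {A<..B}" and min: "\<And>Y. Y \<in> {A<..B} \<Longrightarrow> Y \<le> X \<Longrightarrow> Y = X"
    using finite_has_minimal[of "{A<..B}"] assms by (metis finite greaterThanAtMost_iff empty_iff order_refl)
  have "covered_by A X"
    unfolding covered_by_def using X min
    by (metis greaterThanAtMost_iff less_imp_le less_irrefl order_trans)
  then show thesis using X that by simp
qed

text \<open>The lower end point moves while \<open>B\<close> stays fixed, so facts about intervals
  are proved cover by cover without handling lists.\<close>

lemma cover_induct [consumes 1, case_names refl step]:
  fixes A B :: "'a::{finite,order}"
  assumes "A \<le> B" "P B"
    and step: "\<And>A X. covered_by A X \<Longrightarrow> X \<le> B \<Longrightarrow> P X \<Longrightarrow> P A"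
  shows "P A"
  using assms(1)
proof (induction A rule: upward_induct)
  case (1 A)
  show ?case
  proof (cases "A = B")
    case False
    then obtain X where X: "covered_by A X" "X \<le> B" using 1 ex_cover_below by (metis order_less_le)
    then have "P X" using 1 by (simp add: covered_by_def)
    then show ?thesis using X step by blast
  qed (use assms in simp)
qed

text \<open>Putting \<open>A\<close> below a longest chain of the interval from \<open>X\<close> to
  \<open>B\<close> adds one element. This is what later bounds the rank by the height.\<close>

lemma interval_length_cover_step:
  fixes A X B :: "'a::{finite,order}"
  assumes "covered_by A X" "X \<le> B"
  shows "Suc (interval_length X B) \<le> interval_length A B"
proof -
  let ?S = "\<lambda>A. {card C - 1 | C. C \<subseteq> {A..B} \<and> Complete_Partial_Order.chain (\<le>) C}"
  have ne: "?S X \<noteq> {}" using chain_empty[of "(\<le>)"] by blast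
  have "Max (?S X) \<in> ?S X" by (rule Max_in[OF _ ne]) simp
  then obtain C where C: "Max (?S X) = card C - 1" "C \<subseteq> {X..B}" "Complete_Partial_Order.chain (\<le>) C"
    by blast
  have AX: "A < X" using assms by (simp add: covered_by_def)
  \<comment> \<open>The maximum can be attained by the empty chain, since \<open>0 - 1 = 0\<close>.\<close>
  define D where "D = (if C = {} then {X} else C)"
  have D: "D \<subseteq> {X..B}" "Complete_Partial_Order.chain (\<le>) D" "card D \<noteq> 0" "card D - 1 = card C - 1"
    using C assms by (auto simp: D_def chain_def)
  have "A \<notin> D" using D AX by (metis atLeastAtMost_iff leD subsetD)
  then have "card (insert A D) - 1 = Suc (card D - 1)" using D(3) by (cases "card D") simp_all
  moreover have "insert A D \<subseteq> {A..B}" using D AX assms by fastforce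
  moreover have "Complete_Partial_Order.chain (\<le>) (insert A D)"
    using D AX by (fastforce simp: chain_def)
  ultimately have "Suc (card D - 1) \<in> ?S A"
    by (intro CollectI exI[of _ "insert A D"] conjI) (rule sym)
  then have "Suc (card D - 1) \<le> Max (?S A)" by (intro Max_ge) simp_all
  then show ?thesis unfolding interval_length_def C(1) D(4) .
qed

section \<open>Maximal chains\<close>

text \<open>Peeling off the bottom element matches \<open>cover_induct\<close>. The right-hand side
  mentions \<open>maximal_chain\<close> again, so rewriting with it fixes the lower end point, as in
  \<open>maximal_chain_iff[of A]\<close>, to avoid looping.\<close>

lemma maximal_chain_iff:
  "maximal_chain A B Xs \<longleftrightarrow>
    Xs = [A] \<and> A = B \<or> (\<exists>X Ys. Xs = A # Ys \<and> covered_by A X \<and> maximal_chain X B Ys)"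
  by (cases Xs; cases "tl Xs") (auto simp: maximal_chain_def)

lemma maximal_chain_le: "maximal_chain A B Xs \<Longrightarrow> A \<le> B"
proof (induction Xs arbitrary: A)
  case (Cons Y Ys)
  from Cons.prems show ?case
    unfolding maximal_chain_iff[of A]
    using Cons.IH by (fastforce simp: covered_by_def)
qed (simp add: maximal_chain_def)

lemma ex_maximal_chain:
  fixes A B :: "'a::{finite,order}"
  assumes "A \<le> B"
  shows "\<exists>Xs. maximal_chain A B Xs"
  using assms
proof (induction rule: cover_induct)
  case refl
  then show ?case by (auto simp: maximal_chain_iff[of B])
next
  case (step A X)
  then show ?case by (auto simp: maximal_chain_iff[of A])
qed

lemma chain_weight_singleton [simp]: "chain_weight w [X] = 0"
  by (simp add: chain_weight_def)

lemma chain_weight_Cons: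
  assumes "maximal_chain X B Ys"
  shows "chain_weight w (A # Ys) = w A X + chain_weight w Ys"
proof -
  from assms obtain Zs where Ys: "Ys = X # Zs"
    by (cases Ys) (auto simp: maximal_chain_def)
  \<comment> \<open>Each cover is indexed here by the position of its lower element instead of its
    upper one, which makes the new cover the term at index 0.\<close>
  have "chain_weight w (A # Ys) = (\<Sum>i = 0..<Suc (length Zs). w ((A # Ys) ! i) (Ys ! i))"
    unfolding chain_weight_def Ys
    by (rule sum.reindex_bij_witness[of _ Suc "\<lambda>i. i - 1"]) auto
  also have "\<dots> = w A X + (\<Sum>i = 1..<Suc (length Zs). w ((A # Ys) ! i) (Ys ! i))"
    by (subst sum.atLeast_Suc_lessThan) (auto simp: Ys)
  also have "(\<Sum>i = 1..<Suc (length Zs). w ((A # Ys) ! i) (Ys ! i)) = chain_weight w Ys"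
    unfolding chain_weight_def Ys by (rule sum.cong) (auto simp: nth_Cons split: nat.split)
  finally show ?thesis .
qed

section \<open>Covers in modular lattices\<close>

text \<open>For \<open>Z\<close> strictly between \<open>A\<close> and \<open>sup X A\<close>, the
  cover leaves only \<open>P\<close> and \<open>X\<close> as values of \<open>inf X Z\<close>. The
  first collapses \<open>Z\<close> to \<open>A\<close> by the modular law, the second lifts
  \<open>Z\<close> to the join.\<close>

lemma covered_by_sup:
  fixes A P X :: "'a::modular_lattice"
  assumes "covered_by P X" "P \<le> A" "\<not> X \<le> A"
  shows "covered_by A (sup X A)"
  unfolding covered_by_def
proof (intro conjI notI)
  show "A < sup X A" using assms by (metis sup.cobounded1 sup.cobounded2 order_less_le)
  assume "\<exists>Z. A < Z \<and> Z < sup X A"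
  then obtain Z where Z: "A < Z" "Z < sup X A" by blast
  have "P \<le> inf X Z" "inf X Z \<le> X" using assms Z by (auto simp: covered_by_def)
  then consider "inf X Z = P" | "inf X Z = X"
    using assms(1) unfolding covered_by_def by (metis order_less_le)
  then show False
  proof cases
    case 1
    have "Z = inf (sup A X) Z" using Z by (simp add: inf_absorb2 sup.commute)
    also have "\<dots> = sup A (inf X Z)" using Z modular[of A Z X] by simp
    also have "\<dots> = A" using 1 assms by (simp add: sup_absorb1)
    finally show False using Z by simp
  next
    case 2
    then have "X \<le> Z" by (metis inf.cobounded2)
    then have "sup X A \<le> Z" using Z by simp
    then show False using Z(2) by (metis leD)
  qed
qed

lemma distinct_covers_incomparable:
  assumes "covered_by A X" "covered_by A Y" "X \<noteq> Y"
  shows "\<not> X \<le> Y"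
  using assms by (auto simp: covered_by_def order_less_le)

lemma covered_by_sup_covers:
  fixes A X Y :: "'a::modular_lattice"
  assumes "covered_by A X" "covered_by A Y" "X \<noteq> Y"
  shows "covered_by X (sup X Y)" "covered_by Y (sup X Y)"
proof -
  have "A \<le> X" "A \<le> Y" using assms by (auto simp: covered_by_def)
  moreover have "\<not> X \<le> Y" "\<not> Y \<le> X" using assms distinct_covers_incomparable by metis+
  ultimately show "covered_by X (sup X Y)" "covered_by Y (sup X Y)"
    using covered_by_sup[of A X Y] covered_by_sup[of A Y X] assms by (simp_all add: sup.commute)
qed

text \<open>Elements strictly inside the interval other than \<open>X\<close> are complements of
  \<open>X\<close> in it, and in a modular lattice two comparable complements of one element
  coincide.\<close>

lemma no_chain_between_two_covers:
  fixes A X Y Z Z' :: "'a::modular_lattice"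
  assumes "covered_by A X" "covered_by A Y" "X \<noteq> Y"
    and "A < Z" "Z < Z'" "Z' < sup X Y"
  shows False
proof -
  let ?B = "sup X Y"
  have cov: "covered_by X ?B"
    using covered_by_sup_covers assms by blast
  have X: "inf X V = A \<and> sup V X = ?B" if V: "A < V" "V < ?B" "V \<noteq> X" for V
  proof -
    have "\<not> X \<le> V" using cov V by (auto simp: covered_by_def order_less_le)
    moreover have "\<not> V \<le> X" using assms(1) V by (auto simp: covered_by_def order_less_le)
    ultimately show ?thesis using cov assms(1) V unfolding covered_by_def
      by (metis inf.cobounded1 inf.cobounded2 inf_greatest less_imp_le order_less_le sup.cobounded1
          sup.cobounded2 sup_least)
  qed
  \<comment> \<open>If \<open>X\<close> were one of the two, the other would lie strictly inside a
    cover, either from \<open>A\<close> to \<open>X\<close> or from \<open>X\<close> to the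
    join.\<close>
  have "Z \<noteq> X" "Z' \<noteq> X" using assms cov by (auto simp: covered_by_def)
  then have "inf X Z' = A" "sup Z X = ?B" using X assms by (auto intro: less_trans)
  then have "Z = Z'"
    using modular[of Z Z' X] assms by (simp add: sup_absorb1 inf_absorb2)
  then show False using assms by simp
qed

text \<open>Makes (CW1) and (CW2), assumed only at length 2, available for any two distinct covers
  of an element.\<close>

lemma interval_length_two_covers:
  fixes A X Y :: "'a::{finite,modular_lattice}"
  assumes "covered_by A X" "covered_by A Y" "X \<noteq> Y"
  shows "interval_length A (sup X Y) = 2"
  unfolding interval_length_def
proof (rule Max_eqI)
  let ?B = "sup X Y"
  have XB: "A < X" "X < ?B"
    using assms covered_by_sup_covers[OF assms(1-3)] by (simp_all add: covered_by_def)
  show "2 \<in> {card C - 1 | C. C \<subseteq> {A..?B} \<and> Complete_Partial_Order.chain (\<le>) C}"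
  proof (rule CollectI, intro exI conjI)
    show "2 = card {A, X, ?B} - 1" using XB by (auto simp: card_insert_if)
    show "{A, X, ?B} \<subseteq> {A..?B}" "Complete_Partial_Order.chain (\<le>) {A, X, ?B}"
      using XB by (auto simp: chain_def intro: less_imp_le order_trans)
  qed
  fix n assume "n \<in> {card C - 1 | C. C \<subseteq> {A..?B} \<and> Complete_Partial_Order.chain (\<le>) C}"
  then obtain C where C: "n = card C - 1" "C \<subseteq> {A..?B}" "Complete_Partial_Order.chain (\<le>) C"
    by blast
  \<comment> \<open>Two distinct inner elements would form the excluded chain, so \<open>C\<close>
    has at most one inner element and, with the end points, at most three elements.\<close>
  have "Z = Z'" if "Z \<in> C - {A, ?B}" "Z' \<in> C - {A, ?B}" for Z Z'
  proof -
    have "Z \<le> Z' \<or> Z' \<le> Z" using C that by (auto simp: chain_def)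
    moreover have "A < Z" "Z < ?B" "A < Z'" "Z' < ?B" using C(2) that by (auto simp: order_less_le)
    ultimately show ?thesis
      using no_chain_between_two_covers[OF assms, of Z Z'] no_chain_between_two_covers[OF assms, of Z' Z]
      by (auto simp: order_less_le)
  qed
  then have "card (C - {A, ?B}) \<le> 1"
    unfolding One_nat_def by (subst card_le_Suc0_iff_eq) (simp, blast)
  moreover have "card (C - {A, ?B}) \<ge> card C - card {A, ?B}" by (rule diff_card_le_card_Diff) simp
  moreover have "card {A, ?B} \<le> 2" by (simp add: card_insert_if)
  ultimately show "n \<le> 2" using C by linarith
qed simp

section \<open>Interval weights\<close>

locale cover_weighted =
  fixes w :: "'a::{finite,modular_lattice} \<Rightarrow> 'a \<Rightarrow> real"
  assumes weighting: "cover_weighting w"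
    and CW1: "\<And>A B. A \<le> B \<Longrightarrow> interval_length A B = 2 \<Longrightarrow> CW1 w A B"
    and CW2: "\<And>A B. A \<le> B \<Longrightarrow> interval_length A B = 2 \<Longrightarrow> CW2 w A B"
begin

text \<open>The inequality is (CW2) read as translation: joining with \<open>Y\<close> carries the
  cover of \<open>A\<close> by \<open>X\<close> to that of \<open>Y\<close> by
  \<open>sup X Y\<close>.\<close>

lemma two_covers:
  assumes "covered_by A X" "covered_by A Y" "X \<noteq> Y"
  shows "w A X + w X (sup X Y) = w A Y + w Y (sup X Y)" "w Y (sup X Y) \<le> w A X"
proof -
  have B: "A < X" "X < sup X Y" "A < Y" "Y < sup X Y"
    using assms covered_by_sup_covers[OF assms] by (simp_all add: covered_by_def)
  have "A \<le> sup X Y" using B by (simp add: le_supI1)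
  then have "CW1 w A (sup X Y)" "CW2 w A (sup X Y)"
    using CW1 CW2 interval_length_two_covers[OF assms] by auto
  then show "w A X + w X (sup X Y) = w A Y + w Y (sup X Y)" "w Y (sup X Y) \<le> w A X"
    using B assms(3) unfolding CW1_def CW2_def by blast+
qed

section \<open>Independence of the weight from the maximal chain\<close>

lemma chain_weight_unique:
  assumes "maximal_chain A B Xs" "maximal_chain A B Ys"
  shows "chain_weight w Xs = chain_weight w Ys"
  using assms
proof (induction A arbitrary: Xs Ys rule: upward_induct)
  case (1 A)
  show ?case
  proof (cases "A = B")
    case True
    have "Zs = [A]" if "maximal_chain A B Zs" for Zs
      using that True unfolding maximal_chain_iff[of A]
      by (auto simp: covered_by_def dest: maximal_chain_le)
    then show ?thesis using 1 by metis
  next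
    case False
    with 1 obtain X Xs' Y Ys' where X: "Xs = A # Xs'" "covered_by A X" "maximal_chain X B Xs'"
      and Y: "Ys = A # Ys'" "covered_by A Y" "maximal_chain Y B Ys'"
      unfolding maximal_chain_iff[of A] by blast
    have less: "A < X" "A < Y" using X Y by (auto simp: covered_by_def)
    have "w A X + chain_weight w Xs' = w A Y + chain_weight w Ys'"
    proof (cases "X = Y")
      case True
      then show ?thesis using 1(1)[OF less(1) X(3), of Ys'] Y(3) by simp
    next
      case False
      let ?Z = "sup X Y"
      have "X \<le> B" "Y \<le> B" using X Y by (auto dest: maximal_chain_le)
      \<comment> \<open>\<open>Zs\<close> serves as a common tail: induction at \<open>X\<close> and
        at \<open>Y\<close> replaces each given tail by one through the join, and (CW1) balances the
        remaining steps.\<close>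
      then obtain Zs where Zs: "maximal_chain ?Z B Zs" using ex_maximal_chain[of ?Z B] by auto
      have "covered_by X ?Z" "covered_by Y ?Z"
        using covered_by_sup_covers X Y False by blast+
      then have "maximal_chain X B (X # Zs)" "maximal_chain Y B (Y # Zs)"
        using Zs maximal_chain_iff by blast+
      then have "chain_weight w Xs' = w X ?Z + chain_weight w Zs"
        "chain_weight w Ys' = w Y ?Z + chain_weight w Zs"
        using 1(1)[OF less(1) X(3), of "X # Zs"] 1(1)[OF less(2) Y(3), of "Y # Zs"]
        by (simp_all add: chain_weight_Cons[OF Zs])
      then show ?thesis using two_covers(1)[OF X(2) Y(2) False] by simp
    qed
    then show ?thesis using X Y by (simp add: chain_weight_Cons)
  qed
qed

section \<open>Additivity and bounds for the interval weight\<close>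

lemma interval_weight_eq:
  assumes "maximal_chain A B Xs"
  shows "interval_weight w A B = chain_weight w Xs"
  unfolding interval_weight_def using assms chain_weight_unique by (intro the_equality) blast+

lemma interval_weight_refl [simp]: "interval_weight w A A = 0"
  using interval_weight_eq[of A A "[A]"] by (simp add: maximal_chain_iff[of A])

lemma interval_weight_step:
  assumes "covered_by A X" "X \<le> B"
  shows "interval_weight w A B = w A X + interval_weight w X B"
proof -
  obtain Xs where Xs: "maximal_chain X B Xs" using ex_maximal_chain assms by blast
  then have "maximal_chain A B (A # Xs)" using assms by (auto simp: maximal_chain_iff[of A])
  then show ?thesis using Xs by (simp add: interval_weight_eq chain_weight_Cons)
qed

lemma interval_weight_add:
  assumes "A \<le> B" "B \<le> C"
  shows "interval_weight w A C = interval_weight w A B + interval_weight w B C"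
  using assms(1)
proof (induction rule: cover_induct)
  case (step A X)
  then show ?case
    using interval_weight_step[of A X C] interval_weight_step[of A X B] assms(2) by simp
qed simp

lemma interval_weight_nonneg:
  assumes "A \<le> B"
  shows "0 \<le> interval_weight w A B"
  using assms
proof (induction rule: cover_induct)
  case (step A X)
  then show ?case
    using weighting by (simp add: interval_weight_step cover_weighting_def)
qed simp

text \<open>Each cover contributes at most \<open>t\<close> to the weight and at least one to the
  length.\<close>

lemma interval_weight_le_length:
  assumes "A \<le> B" and t: "0 \<le> t" "\<And>A B. w A B \<le> t"
  shows "interval_weight w A B \<le> t * real (interval_length A B)"
  using assms(1)
proof (induction rule: cover_induct)
  case (step A X)
  have "interval_weight w A B \<le> t + t * real (interval_length X B)"
    using step t by (simp add: interval_weight_step add_mono)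
  also have "\<dots> = t * real (Suc (interval_length X B))" by (simp add: algebra_simps)
  also have "\<dots> \<le> t * real (interval_length A B)"
    using interval_length_cover_step step t by (intro mult_left_mono of_nat_mono) auto
  finally show ?case .
qed (simp add: t)

section \<open>Translation of covers and intervals by joins\<close>

lemma cover_weight_translate_le:
  assumes "P \<le> A" "covered_by P X" "\<not> X \<le> A"
  shows "w A (sup X A) \<le> w P X"
  using assms
proof (induction arbitrary: X rule: cover_induct)
  case refl
  then have "sup X A = X" by (simp add: covered_by_def less_imp_le sup_absorb1)
  then show ?case by simp
next
  case (step P Y)
  have XY: "X \<noteq> Y" using step by auto
  \<comment> \<open>The cover is first carried across the step from \<open>P\<close> to
    \<open>Y\<close>; its image is a different cover, hence the induction over arbitrary
    \<open>X\<close>.\<close>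
  have "covered_by Y (sup X Y)"
    using step XY covered_by_sup_covers by blast
  moreover have "\<not> sup X Y \<le> A" using step by simp
  ultimately have "w A (sup (sup X Y) A) \<le> w Y (sup X Y)" using step.IH by blast
  moreover have "sup (sup X Y) A = sup X A" using step by (simp add: sup.assoc sup_absorb2)
  ultimately show ?case using two_covers(2)[of P X Y] step XY by simp
qed

text \<open>(IW2) is the case where \<open>P\<close> is the meet. A mere common lower bound survives
  the induction without computing meets.\<close>

lemma interval_weight_translate_le:
  assumes "P \<le> X" "P \<le> A"
  shows "interval_weight w A (sup X A) \<le> interval_weight w P X"
  using assms
proof (induction arbitrary: A rule: cover_induct)
  case refl
  then show ?case by (simp add: sup_absorb2)
next
  case (step P Y)
  have PX: "interval_weight w P X = w P Y + interval_weight w Y X"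
    using step by (intro interval_weight_step) auto
  show ?case
  proof (cases "Y \<le> A")
    case True
    \<comment> \<open>Here joining with \<open>A\<close> collapses the first cover, which therefore
      only adds to the right-hand side.\<close>
    have "0 \<le> w P Y" using weighting step by (simp add: cover_weighting_def)
    then show ?thesis using step.IH[OF True] PX by simp
  next
    case False
    \<comment> \<open>Here the first cover translates to a cover of \<open>A\<close>, and the rest
      of the interval is compared with its translate by \<open>sup Y A\<close>.\<close>
    have "sup Y A \<le> sup X A" using step by (simp add: le_supI1)
    then have "interval_weight w A (sup X A) = w A (sup Y A) + interval_weight w (sup Y A) (sup X A)"
      using covered_by_sup[of P Y A] step False by (intro interval_weight_step) auto
    moreover have "w A (sup Y A) \<le> w P Y"
      using cover_weight_translate_le step False by blast
    moreover have "sup X (sup Y A) = sup X A"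
      using step by (simp add: sup.assoc[symmetric] sup_absorb1)
    then have "interval_weight w (sup Y A) (sup X A) \<le> interval_weight w Y X"
      using step.IH[of "sup Y A"] by simp
    ultimately show ?thesis using PX by simp
  qed
qed

end

theorem theorem3p6:
  fixes w :: "'a::{finite,bounded_lattice,modular_lattice} \<Rightarrow> 'a \<Rightarrow> real"
  assumes "cover_weighting w"
    and "\<And>A B. A \<le> B \<Longrightarrow> interval_length A B = 2 \<Longrightarrow> CW1 w A B"
    and "\<And>A B. A \<le> B \<Longrightarrow> interval_length A B = 2 \<Longrightarrow> CW2 w A B"
  shows "IW1 w \<and> IW2 w
    \<and> (\<forall>A Xs. maximal_chain bot A Xs \<longrightarrow> weight_rank w A = chain_weight w Xs)
    \<and> polymatroid (weight_rank w)"
proof -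
  interpret cover_weighted w using assms by unfold_locales
  have IW1: "IW1 w" unfolding IW1_def using chain_weight_unique by blast
  have IW2: "IW2 w"
    unfolding IW2_def using IW1 interval_weight_translate_le by simp
  have rank: "weight_rank w B = weight_rank w A + interval_weight w A B" if "A \<le> B" for A B
    unfolding weight_rank_def using interval_weight_add[of bot A B] that by simp
  \<comment> \<open>The maximum runs over all pairs, so it bounds every cover weight; inserting 0
    ensures that \<open>t\<close> is nonnegative.\<close>
  define t where "t = Max (insert 0 (range (case_prod w)))"
  have t: "0 \<le> t" "w A B \<le> t" for A B
  proof -
    have "w A B \<in> range (case_prod w)" by (rule image_eqI[of _ _ "(A, B)"]) auto
    then show "0 \<le> t" "w A B \<le> t" unfolding t_def by (intro Max_ge; simp)+
  qed
  have "polymatroid (weight_rank w)"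
    unfolding polymatroid_def
  proof (intro conjI allI exI[of _ t])
    show "mono (weight_rank w)"
      using rank interval_weight_nonneg by (fastforce intro: monoI)
    show "0 \<le> weight_rank w A" "weight_rank w A \<le> t * real (height A)" for A
      using interval_weight_nonneg[of bot A] interval_weight_le_length[of bot A t] t
      by (auto simp: weight_rank_def height_def)
    \<comment> \<open>By additivity both differences are interval weights, so submodularity is the
      translation inequality from \<open>inf A B\<close> to \<open>B\<close>.\<close>
    show "weight_rank w (sup A B) - weight_rank w B \<le> weight_rank w A - weight_rank w (inf A B)" for A B
      using rank[of "inf A B" A] rank[of B "sup A B"] interval_weight_translate_le[of "inf A B" A B]
      by simp
  qed (rule t)
  then show ?thesis using IW1 IW2 interval_weight_eq by (auto simp: weight_rank_def)
qed

end
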